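(* Let $f\in C(\mathbb{T})$ and $h>0$. Then $$\frac23\,K_2\bigl(f,h/(2\sqrt{6})\bigr)\le W_2^*(f,\chi_h^2)\le 2\,K_2\bigl(f,h/(2\sqrt{6})\bigr),$$ $$\frac25\,K_2\bigl(f,h/(4\sqrt{3})\bigr)\le W_2^*(f,\chi_h)\le 2\,K_2\bigl(f,h/(4\sqrt{3})\bigr).$$
   Context: $C(\mathbb{T})$, $\mathbb{T}=\mathbb{R}/\mathbb{Z}$, is the space of real continuous $1$-periodic functions with the uniform norm $\|f\|=\sup_{u\in\mathbb{T}}|f(u)|$. $D$ is the derivative operator, and $C^2(\mathbb{T})$ is the space of $1$-periodic functions $g$ with $D^2g\in C(\mathbb{T})$. For a periodic $f$ and a nonnegative integrable $g$ with bounded support on $\mathbb{R}$, $(f*g)(t)=\int_{\mathbb{R}}f(u)\,g(t-u)\,du$. For $h>0$, $\chi_h$ is the function on $\mathbb{R}$ equal to $1/h$ on $(-h/2,h/2)$ and $0$ elsewhere; $\chi_h^1=\chi_h$ and $\chi_h^k=\chi_h^{k-1}*\chi_h$ for $k\ge 2$ are its convolution powers (convolution on $\mathbb{R}$); in particular $\chi_h^2(t)=\frac1h\left(1-\frac{|t|}{h}\right)$ for $|t|<h$ and $0$ otherwise. Define $$W_2(f,\chi_h^k)=\|f-f*\chi_h^k\|,\qquad W_2^*(f,\chi_h^k)=\sup_{0<u\le h}W_2(f,\chi_u^k).$$ For $f\in C(\mathbb{T})$ and $h>0$ the second $K$-functional is $$K_2(f,h)=\inf_{g\in C^2(\mathbb{T})}\{\|f-g\|+h^2\|D^2g\|\}.$$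 *)

theory Defs
  imports "HOL-Analysis.Analysis"
begin

text \<open>
  Functions on the circle \<open>\<real>/\<int>\<close> are represented by 1-periodic functions on \<open>\<real>\<close>; the supremum
  norm may therefore be taken over all of \<open>\<real>\<close>. The real suprema and infima below are
  meaningful (bounded, over nonempty sets) for \<open>f \<in> C_T\<close> and \<open>h > 0\<close>.
\<close>

definition C_T :: "(real \<Rightarrow> real) set" where
  "C_T = {f. continuous_on UNIV f \<and> (\<forall>t. f (t + 1) = f t)}"

definition sup_norm :: "(real \<Rightarrow> real) \<Rightarrow> real" where
  "sup_norm f = (SUP u. \<bar>f u\<bar>)"

text \<open>
  Since \<^const>\<open>deriv\<close> is total, the existence of the two derivatives is required explicitly.
\<close>

definition C2_T :: "(real \<Rightarrow> real) set" where
  "C2_T = {g. (\<forall>t. g (t + 1) = g t) \<and>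
              (\<forall>t. g differentiable at t) \<and>
              (\<forall>t. deriv g differentiable at t) \<and>
              deriv (deriv g) \<in> C_T}"

definition conv :: "(real \<Rightarrow> real) \<Rightarrow> (real \<Rightarrow> real) \<Rightarrow> real \<Rightarrow> real" where
  "conv f g t = (LINT u|lborel. f u * g (t - u))"

definition chi :: "real \<Rightarrow> real \<Rightarrow> real" where
  "chi h t = (if t \<in> {- h / 2<..<h / 2} then 1 / h else 0)"

text \<open>Convolution powers are only specified for exponents \<open>k \<ge> 1\<close>.\<close>

fun chi_pow :: "nat \<Rightarrow> real \<Rightarrow> real \<Rightarrow> real" where
  "chi_pow (Suc 0) h = chi h"
| "chi_pow (Suc (Suc k)) h = conv (chi_pow (Suc k) h) (chi h)"

definition W2 :: "(real \<Rightarrow> real) \<Rightarrow> (real \<Rightarrow> real) \<Rightarrow> real" where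
  "W2 f g = sup_norm (\<lambda>t. f t - conv f g t)"

text \<open>\<open>W2_star f k h\<close> is \<open>W\<^sub>2\<^sup>*(f, \<chi>\<^sub>h\<^sup>k)\<close>; the supremum runs over the whole family
  \<open>\<chi>\<^sub>u\<^sup>k\<close>, \<open>0 < u \<le> h\<close>, so \<open>k\<close> and \<open>h\<close> are passed separately.\<close>

definition W2_star :: "(real \<Rightarrow> real) \<Rightarrow> nat \<Rightarrow> real \<Rightarrow> real" where
  "W2_star f k h = (SUP u\<in>{0<..h}. W2 f (chi_pow k u))"

definition K2 :: "(real \<Rightarrow> real) \<Rightarrow> real \<Rightarrow> real" where
  "K2 f h = (INF g\<in>C2_T. sup_norm (\<lambda>t. f t - g t) + h\<^sup>2 * sup_norm (deriv (deriv g)))"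

end

theory Submission
  imports Defs
begin

text \<open>
  Let \<open>P'' = f\<close>. Writing \<open>\<Delta>\<^sub>u\<close> for the symmetric second difference with step \<open>u\<close>, one has
  \<open>f * \<chi>\<^sub>u\<^sup>2 = \<Delta>\<^sub>u P / u\<^sup>2\<close>. The upper bounds follow by Taylor expansion of the smooth part and
  the contractivity of averaging. For the lower bounds the competitor in the \<open>K\<close>-functional is
  an average of \<open>f * \<chi>\<^sub>u\<^sup>2\<close> over \<open>u\<close>, whose weight is chosen so that its second derivative is a
  multiple of \<open>f * \<chi>\<^sub>h\<^sup>k - f\<close>: the weight is \<open>12 u\<^sup>2 (h - u) / h\<^sup>4\<close> on \<open>(0, h)\<close> for \<open>k = 2\<close>, and
  \<open>24 u\<^sup>2 / h\<^sup>3\<close> on \<open>(0, h/2)\<close> for \<open>k = 1\<close>. For \<open>k = 1\<close> the distance from \<open>f\<close> to this average is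
  at most \<open>2 W\<^sub>2\<^sup>*\<close>, since \<open>f * \<chi>\<^sub>u\<^sup>2\<close> averages twice with \<open>\<chi>\<^sub>u\<close>. With iterated antiderivatives
  of \<open>f\<close> all these averages have closed forms.
\<close>

section \<open>Second differences and antiderivatives\<close>

definition second_diff :: "(real \<Rightarrow> real) \<Rightarrow> real \<Rightarrow> real \<Rightarrow> real" where
  "second_diff P u t = P (t + u) + P (t - u) - 2 * P t"

definition antideriv :: "(real \<Rightarrow> real) \<Rightarrow> (real \<Rightarrow> real) \<Rightarrow> bool" where
  "antideriv F f \<longleftrightarrow> (\<forall>x. (F has_real_derivative f x) (at x))"

lemma antiderivD: "antideriv F f \<Longrightarrow> (F has_real_derivative f x) (at x)"
  by (simp add: antideriv_def)

text \<open>The derivative value \<open>D\<close> is tied down by a separate equation, so the rule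
  combines with \<open>derivative_eq_intros\<close> whatever shape the expected derivative
  has.\<close>

lemma antideriv_chain:
  assumes "antideriv F f" "(g has_real_derivative g') (at x within A)" "f (g x) * g' = D"
  shows "((\<lambda>x. F (g x)) has_real_derivative D) (at x within A)"
  using DERIV_chain2[OF antiderivD[OF assms(1)] assms(2)] assms(3) by simp

lemma antideriv_add:
  "antideriv F f \<Longrightarrow> antideriv G g \<Longrightarrow> antideriv (\<lambda>x. F x + G x) (\<lambda>x. f x + g x)"
  by (auto simp: antideriv_def intro!: derivative_intros)

lemma antideriv_continuous: "antideriv F f \<Longrightarrow> continuous_on A F"
  by (meson antiderivD DERIV_isCont continuous_at_imp_continuous_on)

lemma antideriv_exists:
  assumes "continuous_on UNIV f"
  obtains F where "antideriv F f"
proof -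
  have "\<exists>F. \<forall>x::real. (-\<infinity>::ereal) < x \<longrightarrow> x < (\<infinity>::ereal) \<longrightarrow> (F has_vector_derivative f x) (at x)"
    by (rule einterval_antiderivative)
       (use assms in \<open>auto simp: continuous_on_eq_continuous_at\<close>)
  then show ?thesis
    using that by (auto simp: antideriv_def has_real_derivative_iff_has_vector_derivative)
qed

lemma antiderivs_exist:
  assumes "continuous_on UNIV f"
  obtains F P where "antideriv F f" "antideriv P F"
  using antideriv_exists[OF assms] antideriv_exists antideriv_continuous by metis

text \<open>Clears the denominator of a convolution error, leaving an inequality between differences
  of antiderivatives to which derivative comparison applies.\<close>

lemma abs_diff_divide_le_iff:
  fixes a x y :: real
  assumes "0 < a"
  shows "\<bar>y - x / a\<bar> \<le> B \<longleftrightarrow> \<bar>x - y * a\<bar> \<le> B * a"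
proof -
  have "\<bar>x - y * a\<bar> = \<bar>y - x / a\<bar> * a"
    using assms by (simp add: abs_mult_pos left_diff_distrib abs_minus_commute)
  then show ?thesis
    using assms by simp
qed

text \<open>Both \<open>p - \<phi>\<close> and \<open>p + \<phi>\<close> vanish at 0 and are
  nondecreasing on \<open>[0, u]\<close>. This replaces the integration of inequalities
  below.\<close>

lemma abs_le_if_abs_deriv_le:
  fixes \<phi> p :: "real \<Rightarrow> real"
  assumes "\<And>x. (\<phi> has_real_derivative \<phi>' x) (at x)" "\<And>x. (p has_real_derivative p' x) (at x)"
    and "\<phi> 0 = 0" "p 0 = 0" "\<And>x. 0 \<le> x \<Longrightarrow> x \<le> a \<Longrightarrow> \<bar>\<phi>' x\<bar> \<le> p' x" "0 \<le> u" "u \<le> a"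
  shows "\<bar>\<phi> u\<bar> \<le> p u"
proof -
  have "(\<lambda>x. p x - \<phi> x) 0 \<le> (\<lambda>x. p x - \<phi> x) u"
  proof (rule DERIV_nonneg_imp_nondecreasing[OF \<open>0 \<le> u\<close>])
    fix x assume "0 \<le> x" "x \<le> u"
    then show "\<exists>y. ((\<lambda>x. p x - \<phi> x) has_real_derivative y) (at x) \<and> 0 \<le> y"
      using assms(5)[of x] assms(7)
      by (intro exI[of _ "p' x - \<phi>' x"]) (auto intro!: derivative_intros assms(1,2))
  qed
  moreover have "(\<lambda>x. p x + \<phi> x) 0 \<le> (\<lambda>x. p x + \<phi> x) u"
  proof (rule DERIV_nonneg_imp_nondecreasing[OF \<open>0 \<le> u\<close>])
    fix x assume "0 \<le> x" "x \<le> u"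
    then show "\<exists>y. ((\<lambda>x. p x + \<phi> x) has_real_derivative y) (at x) \<and> 0 \<le> y"
      using assms(5)[of x] assms(7)
      by (intro exI[of _ "p' x + \<phi>' x"]) (auto intro!: derivative_intros assms(1,2))
  qed
  ultimately show ?thesis using assms(3,4) by auto
qed

lemma abs_diff_le:
  assumes F: "antideriv F f" and b: "\<And>x. \<bar>f x\<bar> \<le> M" and u: "0 \<le> u"
  shows "\<bar>F (t + u) - F (t - u)\<bar> \<le> 2 * M * u"
  by (rule abs_le_if_abs_deriv_le[where \<phi> = "\<lambda>v. F (t + v) - F (t - v)" and p = "\<lambda>v. 2 * M * v"
        and \<phi>' = "\<lambda>v. f (t + v) + f (t - v)" and p' = "\<lambda>_. 2 * M" and a = u])
     (use u in \<open>auto intro!: derivative_eq_intros F[THEN antideriv_chain]\<close>,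
      smt (verit) b)

text \<open>The derivative in \<open>u\<close> is \<open>F (t + u) - F (t - u)\<close>, bounded by
  \<open>abs_diff_le\<close>. Read from \<open>P\<close>, this is a Taylor estimate; read from
  \<open>f\<close> and divided by \<open>u\<^sup>2\<close>, it says that averaging with
  \<open>\<chi>\<^sub>u\<^sup>2\<close> preserves bounds.\<close>

lemma abs_second_diff_le:
  assumes F: "antideriv F f" and P: "antideriv P F" and b: "\<And>x. \<bar>f x\<bar> \<le> M" and u: "0 \<le> u"
  shows "\<bar>second_diff P u t\<bar> \<le> M * u\<^sup>2"
  unfolding second_diff_def
  by (rule abs_le_if_abs_deriv_le[where \<phi> = "\<lambda>v. P (t + v) + P (t - v) - 2 * P t"
        and p = "\<lambda>v. M * v\<^sup>2" and \<phi>' = "\<lambda>v. F (t + v) - F (t - v)"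
        and p' = "\<lambda>v. 2 * M * v" and a = u])
     (use u abs_diff_le[OF F b] in \<open>auto intro!: derivative_eq_intros P[THEN antideriv_chain]\<close>)

text \<open>The integral of \<open>second_diff P v t\<close> over \<open>v\<close> in
  \<open>[0, u]\<close> is \<open>Q (t + u) - Q (t - u) - 2 * u * P t\<close>. With
  \<open>c = f t\<close> this averages \<open>f * \<chi>\<^sub>v\<^sup>2\<close> with weight
  \<open>v\<^sup>2\<close>; with \<open>c = 0\<close> it bounds a Taylor remainder.\<close>

lemma integrate_second_diff:
  assumes Q: "antideriv Q P"
    and b: "\<And>v. 0 \<le> v \<Longrightarrow> v \<le> a \<Longrightarrow> \<bar>second_diff P v t - c * v\<^sup>2\<bar> \<le> K * v\<^sup>2"
    and u: "0 \<le> u" "u \<le> a"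
  shows "\<bar>Q (t + u) - Q (t - u) - 2 * u * P t - c * u ^ 3 / 3\<bar> \<le> K * u ^ 3 / 3"
  by (rule abs_le_if_abs_deriv_le[where
        \<phi> = "\<lambda>v. Q (t + v) - Q (t - v) - 2 * v * P t - c * v ^ 3 / 3"
        and p = "\<lambda>v. K * v ^ 3 / 3" and \<phi>' = "\<lambda>v. second_diff P v t - c * v\<^sup>2"
        and p' = "\<lambda>v. K * v\<^sup>2" and a = a])
     (use u b in \<open>auto intro!: derivative_eq_intros Q[THEN antideriv_chain] simp: second_diff_def\<close>)

text \<open>Integrating once more in \<open>u\<close> changes the weight to
  \<open>v\<^sup>2 * (u - v)\<close> on \<open>(0, u)\<close>, of total mass
  \<open>u ^ 4 / 12\<close>.\<close>

lemma integrate_second_diff_twice: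
  assumes Q: "antideriv Q P" and S: "antideriv S Q"
    and b: "\<And>v. 0 \<le> v \<Longrightarrow> v \<le> a \<Longrightarrow> \<bar>second_diff P v t - c * v\<^sup>2\<bar> \<le> K * v\<^sup>2"
    and u: "0 \<le> u" "u \<le> a"
  shows "\<bar>second_diff S u t - u\<^sup>2 * P t - c * u ^ 4 / 12\<bar> \<le> K * u ^ 4 / 12"
  unfolding second_diff_def
  by (rule abs_le_if_abs_deriv_le[where
        \<phi> = "\<lambda>v. S (t + v) + S (t - v) - 2 * S t - v\<^sup>2 * P t - c * v ^ 4 / 12"
        and p = "\<lambda>v. K * v ^ 4 / 12"
        and \<phi>' = "\<lambda>v. Q (t + v) - Q (t - v) - 2 * v * P t - c * v ^ 3 / 3"
        and p' = "\<lambda>v. K * v ^ 3 / 3" and a = a])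
     (use u integrate_second_diff[OF Q b] in \<open>auto intro!: derivative_eq_intros S[THEN antideriv_chain]\<close>)

section \<open>Convolution with the kernels\<close>

lemma conv_chi:
  assumes F: "antideriv F f" and f: "continuous_on UNIV f" and u: "0 < u"
  shows "conv f (chi u) t = (F (t + u / 2) - F (t - u / 2)) / u"
proof -
  have "(LINT v|lborel. f v * indicator {t - u / 2 .. t + u / 2} v) = F (t + u / 2) - F (t - u / 2)"
    by (rule integral_FTC_Icc_real)
       (use u f in \<open>auto simp: continuous_on_eq_continuous_at intro!: antiderivD[OF F]\<close>)
  moreover have "conv f (chi u) t =
      (LINT v|lborel. (f v * indicator {t - u / 2 .. t + u / 2} v) / u)"
    unfolding conv_def
  proof (rule integral_cong_AE)
    show "(\<lambda>v. f v * chi u (t - v)) \<in> borel_measurable lborel"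
      using borel_measurable_continuous_onI[OF f] by (simp add: chi_def)
    show "(\<lambda>v. f v * indicator {t - u / 2 .. t + u / 2} v / u) \<in> borel_measurable lborel"
      using borel_measurable_continuous_onI[OF f] by simp
    \<comment> \<open>The kernel lives on an open interval, the fundamental theorem on its closure;
      they differ by two points.\<close>
    have "AE v in lborel. v \<noteq> t - u / 2" "AE v in lborel. v \<noteq> t + u / 2"
      by (rule AE_lborel_singleton)+
    then show "AE v in lborel. f v * chi u (t - v) = f v * indicator {t - u / 2 .. t + u / 2} v / u"
      by eventually_elim (auto simp: chi_def indicator_def)
  qed
  ultimately show ?thesis by simp
qed

lemma chi_pow_1: "chi_pow 1 u = chi u"
  by simp

text \<open>The product of two interval indicators is the indicator of the overlap, which has length
  \<open>u - \<bar>x\<bar>\<close> or is empty.\<close>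

lemma chi_pow_2:
  assumes u: "0 < u"
  shows "chi_pow 2 u x = max 0 (u - \<bar>x\<bar>) / u\<^sup>2"
proof -
  have "chi_pow 2 u x = conv (chi u) (chi u) x"
    by (simp add: numeral_2_eq_2)
  also have "\<dots> = (LINT v|lborel. indicator {max (- u / 2) (x - u / 2)<..<min (u / 2) (x + u / 2)} v / u\<^sup>2)"
    unfolding conv_def
    by (rule Bochner_Integration.integral_cong)
       (auto simp: chi_def indicator_def power2_eq_square)
  also have "\<dots> = measure lborel {max (- u / 2) (x - u / 2)<..<min (u / 2) (x + u / 2)} / u\<^sup>2"
    by simp
  also have "measure lborel {a<..<b} = max 0 (b - a)" for a b :: real
    by (cases "a \<le> b") auto
  also have "max 0 (min (u / 2) (x + u / 2) - max (- u / 2) (x - u / 2)) = max 0 (u - \<bar>x\<bar>)"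
    by (auto simp: max_def min_def abs_if)
  finally show ?thesis .
qed

lemma conv_chi_pow_2:
  assumes F: "antideriv F f" and P: "antideriv P F" and f: "continuous_on UNIV f" and u: "0 < u"
  shows "conv f (chi_pow 2 u) t = second_diff P u t / u\<^sup>2"
proof -
  have cont: "isCont f x" for x
    using f by (simp add: continuous_on_eq_continuous_at)
  \<comment> \<open>The kernel is affine on each side of \<open>t\<close>; integration by parts
    supplies the antiderivatives in \<open>l\<close> and \<open>r\<close>.\<close>
  have l: "has_bochner_integral lborel (\<lambda>v. (f v * (u - t + v)) * indicator {t - u .. t} v)
      ((\<lambda>v. F v * (u - t + v) - P v) t - (\<lambda>v. F v * (u - t + v) - P v) (t - u))"
    by (rule has_bochner_integral_FTC_Icc_real)
       (use u in \<open>auto intro!: derivative_eq_intros continuous_intros F[THEN antideriv_chain] P[THEN antideriv_chain] cont\<close>)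
  have r: "has_bochner_integral lborel (\<lambda>v. (f v * (u + t - v)) * indicator {t .. t + u} v)
      ((\<lambda>v. F v * (u + t - v) + P v) (t + u) - (\<lambda>v. F v * (u + t - v) + P v) t)"
    by (rule has_bochner_integral_FTC_Icc_real)
       (use u in \<open>auto intro!: derivative_eq_intros continuous_intros F[THEN antideriv_chain] P[THEN antideriv_chain] cont\<close>)
  have m: "f \<in> borel_measurable borel"
    by (rule borel_measurable_continuous_onI[OF f])
  have "conv f (chi_pow 2 u) t =
      (LINT v|lborel. (f v * (u - t + v) * indicator {t - u .. t} v
         + f v * (u + t - v) * indicator {t .. t + u} v) / u\<^sup>2)"
    unfolding conv_def chi_pow_2[OF u]
  proof (rule integral_cong_AE)
    show "(\<lambda>v. f v * (max 0 (u - \<bar>t - v\<bar>) / u\<^sup>2)) \<in> borel_measurable lborel"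
      using m by simp
    show "(\<lambda>v. (f v * (u - t + v) * indicator {t - u .. t} v
         + f v * (u + t - v) * indicator {t .. t + u} v) / u\<^sup>2) \<in> borel_measurable lborel"
      using m by simp
    \<comment> \<open>At \<open>v = t\<close> both indicators are 1 and the kernel would be counted
      twice.\<close>
    have "AE v in lborel. v \<noteq> t"
      by (rule AE_lborel_singleton)
    then show "AE v in lborel. f v * (max 0 (u - \<bar>t - v\<bar>) / u\<^sup>2) =
      (f v * (u - t + v) * indicator {t - u .. t} v
         + f v * (u + t - v) * indicator {t .. t + u} v) / u\<^sup>2"
      by eventually_elim (auto simp: indicator_def max_def algebra_simps)
  qed
  also have "\<dots> = second_diff P u t / u\<^sup>2"
    using has_bochner_integral_integral_eq[OF has_bochner_integral_add[OF l r]]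
    by (simp add: second_diff_def algebra_simps)
  finally show ?thesis .
qed

section \<open>Norms on the circle\<close>

text \<open>Periodicity moves every point to its fractional part in the compact interval
  \<open>[0, 1]\<close>, so the supremum is that of a bounded set.\<close>

lemma C_T_bounded:
  assumes "f \<in> C_T"
  shows "\<bar>f x\<bar> \<le> sup_norm f"
proof -
  have f: "continuous_on UNIV f" and per: "f (t + 1) = f t" for t
    using assms by (auto simp: C_T_def)
  have per_int: "f (t + of_int n) = f t" for t n
  proof (induction n rule: int_induct[where k = 0])
    case (step1 i)
    then show ?case using per[of "t + of_int i"] by (simp add: add.assoc)
  next
    case (step2 i)
    then show ?case using per[of "t + of_int (i - 1)"] by (simp add: algebra_simps)
  qed simp
  have "compact (f ` {0..1})"
    by (intro compact_continuous_image continuous_on_subset[OF f]) auto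
  then obtain B where B: "\<And>y. y \<in> {0..1} \<Longrightarrow> \<bar>f y\<bar> \<le> B"
    using compact_imp_bounded bounded_iff by (metis image_eqI real_norm_def)
  have "\<bar>f y\<bar> \<le> B" for y
  proof -
    have "f (frac y) = f y"
      using per_int[of "frac y" "\<lfloor>y\<rfloor>"] by (simp add: frac_def)
    then show ?thesis
      using B[of "frac y"] frac_ge_0[of y] frac_lt_1[of y] by simp
  qed
  then show ?thesis
    unfolding sup_norm_def by (intro cSUP_upper bdd_aboveI2) auto
qed

lemma sup_norm_le: "(\<And>x. \<bar>f x\<bar> \<le> M) \<Longrightarrow> sup_norm f \<le> M"
  unfolding sup_norm_def by (rule cSUP_least) auto

lemma sup_norm_nonneg: "f \<in> C_T \<Longrightarrow> 0 \<le> sup_norm f"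
  using C_T_bounded[of f 0] by linarith

lemma C_T_diff: "f \<in> C_T \<Longrightarrow> g \<in> C_T \<Longrightarrow> (\<lambda>t. f t - g t) \<in> C_T"
  by (auto simp: C_T_def intro!: continuous_intros)

lemma C2_T_imp:
  assumes "g \<in> C2_T"
  shows "g \<in> C_T" "antideriv g (deriv g)" "antideriv (deriv g) (deriv (deriv g))"
    "deriv (deriv g) \<in> C_T"
proof -
  show d: "antideriv g (deriv g)" "antideriv (deriv g) (deriv (deriv g))"
    using assms by (auto simp: C2_T_def antideriv_def intro: DERIV_deriv_iff_real_differentiable[THEN iffD2])
  show "g \<in> C_T"
    using assms antideriv_continuous[OF d(1)] by (auto simp: C2_T_def C_T_def)
  show "deriv (deriv g) \<in> C_T"
    using assms by (simp add: C2_T_def)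
qed

lemma antideriv_unique_deriv: "antideriv F f \<Longrightarrow> deriv F = f"
  by (auto simp: antideriv_def DERIV_imp_deriv)

lemma antideriv_periodic_deriv:
  assumes F: "antideriv F f" and per: "\<And>t. F (t + 1) = F t"
  shows "f (t + 1) = f t"
proof (rule DERIV_unique)
  show "(F has_real_derivative f t) (at t)"
    by (rule antiderivD[OF F])
  have "((\<lambda>t. F (t + 1)) has_real_derivative f (t + 1)) (at t)"
    by (auto intro!: derivative_eq_intros F[THEN antideriv_chain])
  then show "(F has_real_derivative f (t + 1)) (at t)"
    by (simp add: per)
qed

text \<open>Periodicity passes from \<open>g\<close> to \<open>g'\<close> and on to
  \<open>g''\<close> by uniqueness of derivatives.\<close>

lemma C2_T_I:
  assumes "antideriv g g'" "antideriv g' g''" "continuous_on UNIV g''" "\<And>t. g (t + 1) = g t"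
  shows "g \<in> C2_T" "deriv (deriv g) = g''"
proof -
  note d = antideriv_unique_deriv[OF assms(1)] antideriv_unique_deriv[OF assms(2)]
  have "g'' (t + 1) = g'' t" for t
    by (intro antideriv_periodic_deriv[OF assms(2)] antideriv_periodic_deriv[OF assms(1)] assms(4))
  then show "g \<in> C2_T"
    using assms antiderivD[OF assms(1)] antiderivD[OF assms(2)]
    by (auto simp: C2_T_def C_T_def d real_differentiable_def) blast
  show "deriv (deriv g) = g''"
    by (simp add: d)
qed

lemma K2_le:
  assumes "f \<in> C_T" "g \<in> C2_T" "\<And>t. \<bar>f t - g t\<bar> \<le> A" "\<And>t. \<bar>deriv (deriv g) t\<bar> \<le> B"
  shows "K2 f h \<le> A + h\<^sup>2 * B"
proof -
  have "K2 f h \<le> sup_norm (\<lambda>t. f t - g t) + h\<^sup>2 * sup_norm (deriv (deriv g))"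
    unfolding K2_def
  proof (rule cINF_lower[OF bdd_belowI2 assms(2)])
    fix g assume "g \<in> C2_T"
    then show "0 \<le> sup_norm (\<lambda>t. f t - g t) + h\<^sup>2 * sup_norm (deriv (deriv g))"
      using C2_T_imp[of g] assms(1) by (intro add_nonneg_nonneg mult_nonneg_nonneg sup_norm_nonneg C_T_diff) auto
  qed
  also have "\<dots> \<le> A + h\<^sup>2 * B"
    by (intro add_mono mult_left_mono sup_norm_le assms) auto
  finally show ?thesis .
qed

lemma le_K2:
  assumes "\<And>g. g \<in> C2_T \<Longrightarrow> A \<le> sup_norm (\<lambda>t. f t - g t) + h\<^sup>2 * sup_norm (deriv (deriv g))"
  shows "A \<le> K2 f h"
proof -
  \<comment> \<open>The infimum needs a nonempty index set; the zero function is a witness.\<close>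
  have "(\<lambda>_. 0) \<in> C2_T"
    by (rule C2_T_I[where g' = "\<lambda>_. 0" and g'' = "\<lambda>_. 0"]) (auto simp: antideriv_def)
  then show ?thesis
    unfolding K2_def using assms by (intro cINF_greatest) auto
qed

section \<open>Upper bounds\<close>

text \<open>Split \<open>f = (f - g) + g\<close>. The first part and its average cost
  \<open>\<epsilon>\<close> each; for \<open>g\<close> the error is at most \<open>M\<close> times
  half the second moment of the kernel, which is \<open>u\<^sup>2 / 24\<close> or
  \<open>u\<^sup>2 / 12\<close>.\<close>

lemma conv_error_le:
  assumes f: "f \<in> C_T" and g: "g \<in> C2_T" and u: "0 < u"
    and \<epsilon>: "\<epsilon> = sup_norm (\<lambda>t. f t - g t)" and M: "M = sup_norm (deriv (deriv g))"
  shows "\<bar>f t - conv f (chi_pow 1 u) t\<bar> \<le> 2 * \<epsilon> + u\<^sup>2 / 24 * M"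
    and "\<bar>f t - conv f (chi_pow 2 u) t\<bar> \<le> 2 * \<epsilon> + u\<^sup>2 / 12 * M"
proof -
  note g' = C2_T_imp[OF g]
  have cf: "continuous_on UNIV f" and cg: "continuous_on UNIV g"
    using f g' by (auto simp: C_T_def)
  obtain Q S where QS: "antideriv Q g" "antideriv S Q"
    using antiderivs_exist[OF cg] .
  have "continuous_on UNIV (\<lambda>t. f t - g t)"
    using cf cg by (intro continuous_intros)
  then obtain R T where RT: "antideriv R (\<lambda>t. f t - g t)" "antideriv T R"
    using antiderivs_exist by blast
  have F: "antideriv (\<lambda>x. R x + Q x) f" and P: "antideriv (\<lambda>x. T x + S x) (\<lambda>x. R x + Q x)"
    using antideriv_add[OF RT(1) QS(1)] antideriv_add[OF RT(2) QS(2)] by simp_all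
  have e: "\<bar>f x - g x\<bar> \<le> \<epsilon>" for x
    unfolding \<epsilon> using C_T_bounded[OF C_T_diff[OF f g'(1)]] .
  \<comment> \<open>The term \<open>0 * v\<^sup>2\<close> matches the integration lemmas with
    \<open>c = 0\<close>.\<close>
  have m: "\<bar>second_diff g v t - 0 * v\<^sup>2\<bar> \<le> M * v\<^sup>2" if "0 \<le> v" for v
    using abs_second_diff_le[OF g'(3,2) C_T_bounded[OF g'(4)] that] by (simp add: M)
  have "\<bar>R (t + u / 2) - R (t - u / 2)\<bar> \<le> \<epsilon> * u"
    using abs_diff_le[OF RT(1) e, of "u / 2" t] u by simp
  moreover have "\<bar>Q (t + u / 2) - Q (t - u / 2) - g t * u\<bar> \<le> M * u ^ 3 / 24"
    using integrate_second_diff[OF QS(1) m, of "u / 2" "u / 2"] u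
    by (simp add: power_divide mult.commute)
  moreover have "\<bar>f t * u - g t * u\<bar> \<le> \<epsilon> * u"
    using e[of t] u by (simp add: abs_mult flip: left_diff_distrib)
  moreover have "(2 * \<epsilon> + u\<^sup>2 / 24 * M) * u = 2 * (\<epsilon> * u) + M * u ^ 3 / 24"
    by (simp add: algebra_simps power2_eq_square power3_eq_cube)
  ultimately have "\<bar>R (t + u / 2) + Q (t + u / 2) - (R (t - u / 2) + Q (t - u / 2)) - f t * u\<bar>
      \<le> (2 * \<epsilon> + u\<^sup>2 / 24 * M) * u"
    by linarith
  then show "\<bar>f t - conv f (chi_pow 1 u) t\<bar> \<le> 2 * \<epsilon> + u\<^sup>2 / 24 * M"
    unfolding chi_pow_1 conv_chi[OF F cf u] abs_diff_divide_le_iff[OF u] .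
  have "\<bar>second_diff T u t\<bar> \<le> \<epsilon> * u\<^sup>2"
    using abs_second_diff_le[OF RT e, of u t] u by simp
  moreover have "\<bar>second_diff S u t - g t * u\<^sup>2\<bar> \<le> M * u ^ 4 / 12"
    using integrate_second_diff_twice[OF QS m, of u u] u by (simp add: mult.commute)
  moreover have "\<bar>f t * u\<^sup>2 - g t * u\<^sup>2\<bar> \<le> \<epsilon> * u\<^sup>2"
    using e[of t] u by (simp add: abs_mult flip: left_diff_distrib)
  moreover have "(2 * \<epsilon> + u\<^sup>2 / 12 * M) * u\<^sup>2 = 2 * (\<epsilon> * u\<^sup>2) + M * u ^ 4 / 12"
    by (simp add: algebra_simps power2_eq_square power4_eq_xxxx)
  moreover have "second_diff (\<lambda>x. T x + S x) u t = second_diff T u t + second_diff S u t"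
    by (simp add: second_diff_def)
  ultimately have "\<bar>second_diff (\<lambda>x. T x + S x) u t - f t * u\<^sup>2\<bar> \<le> (2 * \<epsilon> + u\<^sup>2 / 12 * M) * u\<^sup>2"
    by linarith
  then show "\<bar>f t - conv f (chi_pow 2 u) t\<bar> \<le> 2 * \<epsilon> + u\<^sup>2 / 12 * M"
    unfolding conv_chi_pow_2[OF F P cf u] using abs_diff_divide_le_iff u by simp
qed

lemma W2_star_le:
  assumes "0 < h" "\<And>u t. 0 < u \<Longrightarrow> u \<le> h \<Longrightarrow> \<bar>f t - conv f (chi_pow k u) t\<bar> \<le> A"
  shows "W2_star f k h \<le> A"
  unfolding W2_star_def W2_def using assms by (intro cSUP_least sup_norm_le) auto

text \<open>The uniform bound \<open>A\<close> makes the suprema over \<open>t\<close> and over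
  \<open>u\<close> bounded above.\<close>

lemma le_W2_star:
  assumes "\<And>u t. 0 < u \<Longrightarrow> u \<le> h \<Longrightarrow> \<bar>f t - conv f (chi_pow k u) t\<bar> \<le> A"
    and "0 < u" "u \<le> h"
  shows "\<bar>f t - conv f (chi_pow k u) t\<bar> \<le> W2_star f k h"
proof -
  have "\<bar>f t - conv f (chi_pow k u) t\<bar> \<le> W2 f (chi_pow k u)"
    unfolding W2_def sup_norm_def using assms by (intro cSUP_upper bdd_aboveI2) auto
  also have "\<dots> \<le> W2_star f k h"
    unfolding W2_star_def
    by (rule cSUP_upper[OF _ bdd_aboveI2[where M = A]])
       (use assms in \<open>auto simp: W2_def intro!: sup_norm_le\<close>)
  finally show ?thesis .
qed

lemma conv_error_le_W2_star:
  assumes f: "f \<in> C_T" and u: "0 < u" "u \<le> h" and k: "k \<in> {1, 2}"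
  shows "\<bar>f t - conv f (chi_pow k u) t\<bar> \<le> W2_star f k h"
proof (rule le_W2_star[OF _ u])
  fix v t :: real assume v: "0 < v"
  \<comment> \<open>Taking the zero function for \<open>g\<close> in \<open>conv_error_le\<close>
    yields the uniform bound \<open>2 * sup_norm f\<close>.\<close>
  have z: "(\<lambda>_. 0) \<in> C2_T" "deriv (deriv (\<lambda>_. 0 :: real)) = (\<lambda>_. 0)"
    by (rule C2_T_I[where g' = "\<lambda>_. 0" and g'' = "\<lambda>_. 0"]; auto simp: antideriv_def)+
  show "\<bar>f t - conv f (chi_pow k v) t\<bar> \<le> 2 * sup_norm f"
    using conv_error_le[OF f z(1) v refl refl, of t] k by (auto simp: z(2) sup_norm_def)
qed

text \<open>Half of the errors \<open>h\<^sup>2 / 24 * M\<close> and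
  \<open>h\<^sup>2 / 12 * M\<close> gives the squared arguments of \<open>K2\<close>:
  \<open>h\<^sup>2 / 48\<close> and \<open>h\<^sup>2 / 24\<close>.\<close>

lemma W2_star_le_K2:
  assumes f: "f \<in> C_T" and h: "0 < h"
  shows "W2_star f 1 h \<le> 2 * K2 f (h / (4 * sqrt 3))"
    and "W2_star f 2 h \<le> 2 * K2 f (h / (2 * sqrt 6))"
proof -
  have "W2_star f 1 h / 2 \<le> K2 f (h / (4 * sqrt 3))"
  proof (rule le_K2)
    fix g assume g: "g \<in> C2_T"
    define \<epsilon> M where "\<epsilon> = sup_norm (\<lambda>t. f t - g t)" "M = sup_norm (deriv (deriv g))"
    have "W2_star f 1 h \<le> 2 * \<epsilon> + h\<^sup>2 / 24 * M"
    proof (rule W2_star_le[OF h])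
      fix u t assume u: "0 < u" "u \<le> h"
      have "u\<^sup>2 / 24 * M \<le> h\<^sup>2 / 24 * M"
        using u C2_T_imp(4)[OF g] by (intro mult_right_mono) (auto simp: \<epsilon>_M_def sup_norm_nonneg)
      then show "\<bar>f t - conv f (chi_pow 1 u) t\<bar> \<le> 2 * \<epsilon> + h\<^sup>2 / 24 * M"
        using conv_error_le(1)[OF f g u(1) \<epsilon>_M_def, of t] by linarith
    qed
    then show "W2_star f 1 h / 2 \<le> sup_norm (\<lambda>t. f t - g t)
        + (h / (4 * sqrt 3))\<^sup>2 * sup_norm (deriv (deriv g))"
      by (simp add: \<epsilon>_M_def power_divide power_mult_distrib mult.commute)
  qed
  then show "W2_star f 1 h \<le> 2 * K2 f (h / (4 * sqrt 3))" by simp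
  have "W2_star f 2 h / 2 \<le> K2 f (h / (2 * sqrt 6))"
  proof (rule le_K2)
    fix g assume g: "g \<in> C2_T"
    define \<epsilon> M where "\<epsilon> = sup_norm (\<lambda>t. f t - g t)" "M = sup_norm (deriv (deriv g))"
    have "W2_star f 2 h \<le> 2 * \<epsilon> + h\<^sup>2 / 12 * M"
    proof (rule W2_star_le[OF h])
      fix u t assume u: "0 < u" "u \<le> h"
      have "u\<^sup>2 / 12 * M \<le> h\<^sup>2 / 12 * M"
        using u C2_T_imp(4)[OF g] by (intro mult_right_mono) (auto simp: \<epsilon>_M_def sup_norm_nonneg)
      then show "\<bar>f t - conv f (chi_pow 2 u) t\<bar> \<le> 2 * \<epsilon> + h\<^sup>2 / 12 * M"
        using conv_error_le(2)[OF f g u(1) \<epsilon>_M_def, of t] by linarith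
    qed
    then show "W2_star f 2 h / 2 \<le> sup_norm (\<lambda>t. f t - g t)
        + (h / (2 * sqrt 6))\<^sup>2 * sup_norm (deriv (deriv g))"
      by (simp add: \<epsilon>_M_def power_divide power_mult_distrib mult.commute)
  qed
  then show "W2_star f 2 h \<le> 2 * K2 f (h / (2 * sqrt 6))" by simp
qed

section \<open>Lower bounds\<close>

text \<open>Serves the periodicity of the competitors: shift differences of iterated antiderivatives
  of a periodic \<open>f\<close> form a chain of antiderivatives that starts from 0.\<close>

lemma antideriv_shift_diff:
  assumes "antideriv F f"
  shows "antideriv (\<lambda>x. F (x + 1) - F x) (\<lambda>x. f (x + 1) - f x)"
  unfolding antideriv_def by (auto intro!: derivative_eq_intros assms[THEN antideriv_chain])

lemma K2_le_W2_star_2: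
  assumes f: "f \<in> C_T" and h: "0 < h"
  shows "2 / 3 * K2 f (h / (2 * sqrt 6)) \<le> W2_star f 2 h"
proof -
  define W where "W = W2_star f 2 h"
  have cf: "continuous_on UNIV f" and per: "f (t + 1) = f t" for t
    using f by (auto simp: C_T_def)
  obtain F P where FP: "antideriv F f" "antideriv P F"
    using antiderivs_exist[OF cf] .
  obtain Q S where QS: "antideriv Q P" "antideriv S Q"
    using antiderivs_exist[OF antideriv_continuous[OF FP(2)]] .
  \<comment> \<open>Closed form of the average of \<open>f * \<chi>\<^sub>u\<^sup>2\<close> with
    weight \<open>12 * u\<^sup>2 * (h - u) / h ^ 4\<close>. Here \<open>g''\<close> equals
    \<open>12 / h\<^sup>2\<close> times \<open>f * \<chi>\<^sub>h\<^sup>2 - f\<close>.\<close>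
  define g where "g t = 12 / h ^ 4 * (second_diff S h t - h\<^sup>2 * P t)" for t
  define g' where "g' t = 12 / h ^ 4 * (second_diff Q h t - h\<^sup>2 * F t)" for t
  define g'' where "g'' t = 12 / h ^ 4 * (second_diff P h t - h\<^sup>2 * f t)" for t
  have b: "\<bar>second_diff P v t - f t * v\<^sup>2\<bar> \<le> W * v\<^sup>2" if "0 \<le> v" "v \<le> h" for v t
  proof (cases "v = 0")
    case False
    then have v: "0 < v" using that by simp
    then show ?thesis
      using conv_error_le_W2_star[OF f v \<open>v \<le> h\<close>, of 2 t]
      by (simp add: conv_chi_pow_2[OF FP cf v] W_def abs_diff_divide_le_iff)
  qed (simp add: second_diff_def)
  have "antideriv g g'"
    unfolding antideriv_def g_def g'_def second_diff_def
    by (intro allI DERIV_cmult)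
       (auto intro!: derivative_eq_intros QS[THEN antideriv_chain] FP[THEN antideriv_chain] simp: algebra_simps)
  moreover have "antideriv g' g''"
    unfolding antideriv_def g'_def g''_def second_diff_def
    by (intro allI DERIV_cmult)
       (auto intro!: derivative_eq_intros QS[THEN antideriv_chain] FP[THEN antideriv_chain] simp: algebra_simps)
  moreover have "continuous_on UNIV g''"
    unfolding g''_def second_diff_def
    by (intro continuous_intros cf continuous_on_compose2[OF antideriv_continuous[OF FP(2), of UNIV]]) auto
  moreover have "g (t + 1) = g t" for t
  proof -
    \<comment> \<open>\<open>P\<close> need not be periodic, but \<open>P (x + 1) - P x\<close> is affine, so its Taylor error vanishes.\<close>
    have "\<bar>second_diff (\<lambda>x. P (x + 1) - P x) v t - 0 * v\<^sup>2\<bar> \<le> 0 * v\<^sup>2" if "0 \<le> v" for v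
      using abs_second_diff_le[OF FP[THEN antideriv_shift_diff], of 0 v t] that by (simp add: per)
    from integrate_second_diff_twice[OF QS[THEN antideriv_shift_diff] this, of h h] h
    have "second_diff S h (t + 1) - h\<^sup>2 * P (t + 1) = second_diff S h t - h\<^sup>2 * P t"
      by (simp add: second_diff_def algebra_simps)
    then show ?thesis by (simp only: g_def)
  qed
  ultimately have g: "g \<in> C2_T" "deriv (deriv g) = g''"
    by (auto intro: C2_T_I)
  have "\<bar>f t - g t\<bar> \<le> W" for t
  proof -
    have "\<bar>second_diff S h t - h\<^sup>2 * P t - f t * h ^ 4 / 12\<bar> \<le> W * h ^ 4 / 12"
      using integrate_second_diff_twice[OF QS b, of h h] h by simp
    then show ?thesis
      using h abs_diff_divide_le_iff[of "h ^ 4 / 12" "f t" "second_diff S h t - h\<^sup>2 * P t" W]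
      by (simp add: g_def mult.commute)
  qed
  moreover have "\<bar>g'' t\<bar> \<le> 12 / h\<^sup>2 * W" for t
  proof -
    have "\<bar>g'' t\<bar> \<le> 12 / h ^ 4 * (W * h\<^sup>2)"
      using b[of h t] h by (simp add: g''_def abs_mult mult.commute divide_right_mono)
    then show ?thesis
      using h by (simp add: power2_eq_square power4_eq_xxxx)
  qed
  \<comment> \<open>The second summand is
    \<open>h\<^sup>2 / 24 * (12 / h\<^sup>2 * W) = W / 2\<close>, so the total is
    \<open>3 / 2 * W\<close>.\<close>
  ultimately have "K2 f (h / (2 * sqrt 6)) \<le> W + (h / (2 * sqrt 6))\<^sup>2 * (12 / h\<^sup>2 * W)"
    using f g by (intro K2_le) auto
  then show ?thesis
    using h by (simp add: power_divide power_mult_distrib W_def)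
qed

text \<open>With \<open>e = f - f * \<chi>\<^sub>u\<close>, the error for
  \<open>\<chi>\<^sub>u\<^sup>2\<close> is \<open>e + e * \<chi>\<^sub>u\<close>, and each summand
  is at most \<open>W2_star f 1 h\<close>.\<close>

lemma conv_2_error_le:
  assumes f: "f \<in> C_T" and u: "0 < u" "u \<le> h"
  shows "\<bar>f t - conv f (chi_pow 2 u) t\<bar> \<le> 2 * W2_star f 1 h"
proof -
  have cf: "continuous_on UNIV f"
    using f by (auto simp: C_T_def)
  obtain F P where FP: "antideriv F f" "antideriv P F"
    using antiderivs_exist[OF cf] .
  have b: "\<bar>f x - (F (x + u / 2) - F (x - u / 2)) / u\<bar> \<le> W2_star f 1 h" for x
    using conv_error_le_W2_star[OF f u, of 1 x] conv_chi[OF FP(1) cf u(1)] by (simp add: chi_pow_1[simplified])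
  \<comment> \<open>An antiderivative of \<open>e\<close>; its increment over
    \<open>[t - u / 2, t + u / 2]\<close>, divided by \<open>u\<close>, is
    \<open>e * \<chi>\<^sub>u\<close> at \<open>t\<close>.\<close>
  have "antideriv (\<lambda>x. F x - (P (x + u / 2) - P (x - u / 2)) / u)
      (\<lambda>x. f x - (F (x + u / 2) - F (x - u / 2)) / u)"
    unfolding antideriv_def using u by (auto intro!: derivative_eq_intros FP[THEN antideriv_chain])
  from abs_diff_le[OF this b, of "u / 2" t]
  have "\<bar>F (t + u / 2) - F (t - u / 2) - second_diff P u t / u\<bar> \<le> W2_star f 1 h * u"
    using u by (simp add: second_diff_def diff_divide_distrib add_divide_distrib algebra_simps)
  then have "\<bar>F (t + u / 2) - F (t - u / 2) - second_diff P u t / u\<bar> / u \<le> W2_star f 1 h"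
    using u by (simp add: field_simps)
  then have "\<bar>(F (t + u / 2) - F (t - u / 2) - second_diff P u t / u) / u\<bar> \<le> W2_star f 1 h"
    using u by simp
  then show ?thesis
    using b[of t] conv_chi_pow_2[OF FP cf u(1)]
    by (simp add: diff_divide_distrib power2_eq_square)
qed

lemma K2_le_W2_star_1:
  assumes f: "f \<in> C_T" and h: "0 < h"
  shows "2 / 5 * K2 f (h / (4 * sqrt 3)) \<le> W2_star f 1 h"
proof -
  define W where "W = W2_star f 1 h"
  have cf: "continuous_on UNIV f" and per: "f (t + 1) = f t" for t
    using f by (auto simp: C_T_def)
  obtain F P where FP: "antideriv F f" "antideriv P F"
    using antiderivs_exist[OF cf] .
  obtain Q where Q: "antideriv Q P"
    using antideriv_exists[OF antideriv_continuous[OF FP(2)]] .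
  \<comment> \<open>Averaging only up to \<open>h / 2\<close> with weight
    \<open>24 * u\<^sup>2 / h ^ 3\<close> makes \<open>g''\<close> equal to
    \<open>24 / h\<^sup>2\<close> times \<open>f * \<chi>\<^sub>h - f\<close>.\<close>
  define g where "g t = 24 / h ^ 3 * (Q (t + h / 2) - Q (t - h / 2) - h * P t)" for t
  define g' where "g' t = 24 / h ^ 3 * (P (t + h / 2) - P (t - h / 2) - h * F t)" for t
  define g'' where "g'' t = 24 / h ^ 3 * (F (t + h / 2) - F (t - h / 2) - h * f t)" for t
  have b: "\<bar>second_diff P v t - f t * v\<^sup>2\<bar> \<le> (2 * W) * v\<^sup>2" if "0 \<le> v" "v \<le> h" for v t
  proof (cases "v = 0")
    case False
    then have v: "0 < v" using that by simp
    then show ?thesis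
      using conv_2_error_le[OF f v \<open>v \<le> h\<close>, of t]
      by (simp add: conv_chi_pow_2[OF FP cf v] W_def abs_diff_divide_le_iff)
  qed (simp add: second_diff_def)
  have "antideriv g g'"
    unfolding antideriv_def g_def g'_def
    by (intro allI DERIV_cmult)
       (auto intro!: derivative_eq_intros Q[THEN antideriv_chain] FP[THEN antideriv_chain] simp: algebra_simps)
  moreover have "antideriv g' g''"
    unfolding antideriv_def g'_def g''_def
    by (intro allI DERIV_cmult)
       (auto intro!: derivative_eq_intros Q[THEN antideriv_chain] FP[THEN antideriv_chain] simp: algebra_simps)
  moreover have "continuous_on UNIV g''"
    unfolding g''_def
    by (intro continuous_intros cf continuous_on_compose2[OF antideriv_continuous[OF FP(1), of UNIV]]) auto
  moreover have "g (t + 1) = g t" for t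
  proof -
    \<comment> \<open>With both constants 0 the integrated estimate becomes an equation: the bracket
      defining \<open>g\<close> has period 1.\<close>
    have "\<bar>second_diff (\<lambda>x. P (x + 1) - P x) v t - 0 * v\<^sup>2\<bar> \<le> 0 * v\<^sup>2" if "0 \<le> v" for v
      using abs_second_diff_le[OF FP[THEN antideriv_shift_diff], of 0 v t] that by (simp add: per)
    from integrate_second_diff[OF Q[THEN antideriv_shift_diff] this, of "h / 2" "h / 2"] h
    have "Q (t + 1 + h / 2) - Q (t + 1 - h / 2) - h * P (t + 1) = Q (t + h / 2) - Q (t - h / 2) - h * P t"
      by (simp add: algebra_simps)
    then show ?thesis by (simp only: g_def)
  qed
  ultimately have g: "g \<in> C2_T" "deriv (deriv g) = g''"
    by (auto intro: C2_T_I)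
  have "\<bar>f t - g t\<bar> \<le> 2 * W" for t
  proof -
    have "\<bar>Q (t + h / 2) - Q (t - h / 2) - h * P t - f t * h ^ 3 / 24\<bar> \<le> W * h ^ 3 / 12"
      using integrate_second_diff[OF Q b, of "h / 2" "h / 2"] h by (simp add: power_divide)
    then show ?thesis
      using h abs_diff_divide_le_iff[of "h ^ 3 / 24" "f t" "Q (t + h / 2) - Q (t - h / 2) - h * P t" "2 * W"]
      by (simp add: g_def mult.commute)
  qed
  \<comment> \<open>Here the error of the single average \<open>f * \<chi>\<^sub>h\<close> enters,
    so the bound is \<open>W\<close> and not \<open>2 * W\<close>.\<close>
  moreover have "\<bar>g'' t\<bar> \<le> 24 / h\<^sup>2 * W" for t
  proof -
    have "\<bar>f t - (F (t + h / 2) - F (t - h / 2)) / h\<bar> \<le> W"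
      using conv_error_le_W2_star[OF f h order_refl, of 1 t] conv_chi[OF FP(1) cf h]
      by (simp add: chi_pow_1[simplified] W_def)
    then have "24 / h\<^sup>2 * \<bar>f t - (F (t + h / 2) - F (t - h / 2)) / h\<bar> \<le> 24 / h\<^sup>2 * W"
      by (intro mult_left_mono) auto
    moreover have "g'' t = - (24 / h\<^sup>2 * (f t - (F (t + h / 2) - F (t - h / 2)) / h))"
      using h by (simp add: g''_def field_simps power2_eq_square power3_eq_cube)
    ultimately show ?thesis
      by (simp only: abs_minus_cancel abs_mult) simp
  qed
  \<comment> \<open>The second summand is
    \<open>h\<^sup>2 / 48 * (24 / h\<^sup>2 * W) = W / 2\<close>, so the total is
    \<open>5 / 2 * W\<close>.\<close>
  ultimately have "K2 f (h / (4 * sqrt 3)) \<le> 2 * W + (h / (4 * sqrt 3))\<^sup>2 * (24 / h\<^sup>2 * W)"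
    using f g by (intro K2_le) auto
  then show ?thesis
    using h by (simp add: power_divide power_mult_distrib W_def)
qed

theorem theorem1:
  fixes f :: "real \<Rightarrow> real" and h :: real
  assumes "f \<in> C_T" and "h > 0"
  shows "2 / 3 * K2 f (h / (2 * sqrt 6)) \<le> W2_star f 2 h \<and>
         W2_star f 2 h \<le> 2 * K2 f (h / (2 * sqrt 6)) \<and>
         2 / 5 * K2 f (h / (4 * sqrt 3)) \<le> W2_star f 1 h \<and>
         W2_star f 1 h \<le> 2 * K2 f (h / (4 * sqrt 3))"
  using assms W2_star_le_K2 K2_le_W2_star_1 K2_le_W2_star_2 by blast

end
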